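(* Let $S=[A_S;P_S;B_S]$ be a recursive system and $[\Lambda]$ an R-derivation in $S$. (a) Suppose that no R-formula of $B_S$ contains an equation as an R-subformula. Let $[\hat\Lambda]$ result from $[\Lambda]$ by removing all steps which contain an equation as an R-subformula and all steps of the form $\to F\,F$ with $F$ a prime R-formula. Then $[\hat\Lambda]$ is again an R-derivation in $S$. (b) Let $\sim^*$ be a new predicate symbol not occurring among the other symbols, $P_S^*=P_S\cup\{\sim^*\}$, and for an R-formula $F$ let $F^*$ result from $F$ by replacing every occurrence of the symbol $\sim$ by $\sim^*$. Let $B_S^*$ be the finite list consisting of the following R-formulas, where $x,y,s,t$ are distinct variables and $x_1,\dots,x_n,y_1,\dots,y_n$ are distinct variables: (i) $F^*$ for all $F\in B_S$; (ii) $\sim^*x,x$; (iii) $\to\sim^*x,x\to\sim^*x,y\ \sim^*y,x$; (iv) $\to\sim^*x,y\to\sim^*y,s\ \sim^*x,s$; (v) $\to\sim^*f(x),f(x)\to\sim^*x,y\ \sim^*f(x),f(y)$ for each $f\in A_S$; (vi) $\to\sim^*xs,xs\to\sim^*s,t\ \sim^*xs,xt$; (vii) $\to\sim^*xs,xt\to\sim^*x,y\ \sim^*xs,yt$; (viii) $\to\sim^*x_1,y_1\dots\to\sim^*x_n,y_n\to p\,x_1,\dots,x_n\ p\,y_1,\dots,y_n$ for all $p\in P_S$ and all $n\ge1$ such that $p$ occurs as an $n$-ary prime R-subformula in $B_S$. Let $S^*=[A_S;P_S^*;B_S^*]$. Then for every $n\ge0$, $p\in P_S$ and $A_S$-lists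 $\lambda,\mu,\lambda_1,\dots,\lambda_n$: $p\,\lambda_1,\dots,\lambda_n$ (which means $p$ if $n=0$) is R-derivable in $S$ if and only if it is R-derivable in $S^*$, and $\sim\lambda,\mu$ is R-derivable in $S$ if and only if $\sim^*\lambda,\mu$ is R-derivable in $S^*$.
   Context: A recursive system $S=[A_S;P_S;B_S]$ is given by a finite set $A_S$ of constant/operation symbols, a finite set $P_S$ of predicate symbols, a fixed countably infinite set $X$ of variables and the auxiliary symbols $\sim,(,),\,,\,,\to$ (pairwise disjoint), together with a finite (possibly empty) list $B_S$ of R-formulas, the basis R-axioms. Lists: every $a\in A_S$ and every $x\in X$ is a list; $f(\lambda)$ is a list for $f\in A_S$ and a list $\lambda$; the concatenation $\lambda\mu$ of lists is a list. Prime R-formulas: equations $\sim\lambda,\mu$, and $p$, $p\,\lambda_1$, $p\,\lambda_1,\lambda_2$, … ($n$-ary for $n$ argument lists) for $p\in P_S$ and lists $\lambda_i$. R-formulas: prime R-formulas, and $\to F\,G$ with $F$ prime and $G$ an R-formula; the R-subformulas of $\to F\,G$ are itself, $F$, and the R-subformulas of $G$. $F\frac{\lambda}{x}=\mathrm{SbF}(F;\lambda;x)$ replaces every occurrence of $x$ in $F$ by $\lambda$. R-axioms of equality: $\sim x,x$; $\to\mathrm{SbF}(\sim\lambda,\mu;x;y)\to\ \sim x,y\ \sim\lambda,\mu$ for $x,y\in X$ and lists $\lambda,\mu$; $\to\sim x_1,y_1\dots\to\sim x_n,y_n\to p\,x_1,\dots,x_n\ p\,y_1,\dots,y_n$ for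 $p\in P_S$, $n\ge1$, $x_i,y_i\in X$. The R-axioms of $S$ are the R-axioms of equality and the members of $B_S$. An R-derivation is a finite list of R-formulas built from the empty list by appending (a) an R-axiom, (b) $G$ whenever $F$ and $\to F\,G$ are already steps, or (c) $F\frac{\lambda}{x}$ whenever $F$ is a step, $x\in X$, $\lambda$ any list. An R-formula is R-derivable if it is a step of some R-derivation. *)

theory Defs
  imports Main
begin

section \<open>Recursive systems\<close>

text \<open>Symbol strings are represented by their parse trees. Constant/operation symbols, predicate
  symbols, variables and auxiliary symbols live in different types or constructors and are
  therefore disjoint. Lists are flat sequences of items, so that concatenation is associative, as
  it is for strings; the empty sequence is not a list.\<close>

type_synonym var = nat

datatype 'a item = Const 'a | Var var | App 'a "'a item list"

datatype ('a, 'p) pform =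
    Eq "'a item list" "'a item list"
  | Pred 'p "'a item list list"

datatype ('a, 'p) rform =
    Prime "('a, 'p) pform"
  | Imp "('a, 'p) pform" "('a, 'p) rform"

record ('a, 'p) rsystem =
  csyms :: "'a set"
  psyms :: "'p set"
  basis :: "('a, 'p) rform list"

inductive is_list :: "'a set \<Rightarrow> 'a item list \<Rightarrow> bool" for A where
  Const: "a \<in> A \<Longrightarrow> is_list A [Const a]"
| Var: "is_list A [Var x]"
| App: "f \<in> A \<Longrightarrow> is_list A l \<Longrightarrow> is_list A [App f l]"
| append: "is_list A l \<Longrightarrow> is_list A m \<Longrightarrow> is_list A (l @ m)"

fun is_pform :: "'a set \<Rightarrow> 'p set \<Rightarrow> ('a, 'p) pform \<Rightarrow> bool" where
  "is_pform A P (Eq l m) \<longleftrightarrow> is_list A l \<and> is_list A m"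
| "is_pform A P (Pred p ls) \<longleftrightarrow> p \<in> P \<and> (\<forall>l\<in>set ls. is_list A l)"

fun is_rform :: "'a set \<Rightarrow> 'p set \<Rightarrow> ('a, 'p) rform \<Rightarrow> bool" where
  "is_rform A P (Prime F) \<longleftrightarrow> is_pform A P F"
| "is_rform A P (Imp F G) \<longleftrightarrow> is_pform A P F \<and> is_rform A P G"

definition recursive_system :: "('a, 'p) rsystem \<Rightarrow> bool" where
  "recursive_system S \<longleftrightarrow> finite (csyms S) \<and> finite (psyms S)
     \<and> (\<forall>F\<in>set (basis S). is_rform (csyms S) (psyms S) F)"

fun subforms :: "('a, 'p) rform \<Rightarrow> ('a, 'p) rform set" where
  "subforms (Prime F) = {Prime F}"
| "subforms (Imp F G) = {Imp F G, Prime F} \<union> subforms G"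

section \<open>Substitution\<close>

text \<open>As in $\mathrm{SbF}(F;\lambda;x)$, the replacing list comes before the replaced variable.\<close>

fun sb_item :: "'a item list \<Rightarrow> var \<Rightarrow> 'a item \<Rightarrow> 'a item list" where
  "sb_item l x (Const a) = [Const a]"
| "sb_item l x (Var y) = (if y = x then l else [Var y])"
| "sb_item l x (App f m) = [App f (concat (map (sb_item l x) m))]"

definition sb_list :: "'a item list \<Rightarrow> 'a item list \<Rightarrow> var \<Rightarrow> 'a item list" where
  "sb_list m l x = concat (map (sb_item l x) m)"

fun sb_pform :: "('a, 'p) pform \<Rightarrow> 'a item list \<Rightarrow> var \<Rightarrow> ('a, 'p) pform" where
  "sb_pform (Eq m m') l x = Eq (sb_list m l x) (sb_list m' l x)"
| "sb_pform (Pred p ms) l x = Pred p (map (\<lambda>m. sb_list m l x) ms)"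

fun SbF :: "('a, 'p) rform \<Rightarrow> 'a item list \<Rightarrow> var \<Rightarrow> ('a, 'p) rform" where
  "SbF (Prime F) l x = Prime (sb_pform F l x)"
| "SbF (Imp F G) l x = Imp (sb_pform F l x) (SbF G l x)"

section \<open>R-axioms and R-derivations\<close>

abbreviation var_list :: "var \<Rightarrow> 'a item list" where
  "var_list x \<equiv> [Var x]"

abbreviation imps :: "('a, 'p) pform list \<Rightarrow> ('a, 'p) rform \<Rightarrow> ('a, 'p) rform" where
  "imps Fs G \<equiv> foldr Imp Fs G"

definition pred_cong :: "('a item list \<Rightarrow> 'a item list \<Rightarrow> ('a, 'p) pform) \<Rightarrow> 'p
    \<Rightarrow> var list \<Rightarrow> var list \<Rightarrow> ('a, 'p) rform" where
  "pred_cong e p xs ys =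
     imps (map2 (\<lambda>x y. e (var_list x) (var_list y)) xs ys)
       (Imp (Pred p (map var_list xs)) (Prime (Pred p (map var_list ys))))"

inductive eq_axiom :: "('a, 'p) rsystem \<Rightarrow> ('a, 'p) rform \<Rightarrow> bool" for S where
  refl: "eq_axiom S (Prime (Eq (var_list x) (var_list x)))"
| subst: "is_list (csyms S) l \<Longrightarrow> is_list (csyms S) m \<Longrightarrow>
    eq_axiom S (Imp (sb_pform (Eq l m) (var_list x) y)
      (Imp (Eq (var_list x) (var_list y)) (Prime (Eq l m))))"
| pred: "p \<in> psyms S \<Longrightarrow> length xs = length ys \<Longrightarrow> length xs \<ge> 1 \<Longrightarrow>
    eq_axiom S (pred_cong Eq p xs ys)"

definition R_axiom :: "('a, 'p) rsystem \<Rightarrow> ('a, 'p) rform \<Rightarrow> bool" where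
  "R_axiom S F \<longleftrightarrow> eq_axiom S F \<or> F \<in> set (basis S)"

inductive R_derivation :: "('a, 'p) rsystem \<Rightarrow> ('a, 'p) rform list \<Rightarrow> bool" for S where
  Nil: "R_derivation S []"
| axiom: "R_derivation S L \<Longrightarrow> R_axiom S F \<Longrightarrow> R_derivation S (L @ [F])"
| mp: "R_derivation S L \<Longrightarrow> Prime F \<in> set L \<Longrightarrow> Imp F G \<in> set L \<Longrightarrow> R_derivation S (L @ [G])"
| subst: "R_derivation S L \<Longrightarrow> F \<in> set L \<Longrightarrow> is_list (csyms S) l \<Longrightarrow>
    R_derivation S (L @ [SbF F l x])"

definition R_derivable :: "('a, 'p) rsystem \<Rightarrow> ('a, 'p) rform \<Rightarrow> bool" where
  "R_derivable S F \<longleftrightarrow> (\<exists>L. R_derivation S L \<and> F \<in> set L)"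

section \<open>Elimination of equations\<close>

definition contains_eq :: "('a, 'p) rform \<Rightarrow> bool" where
  "contains_eq F \<longleftrightarrow> (\<exists>l m. Prime (Eq l m) \<in> subforms F)"

definition self_imp :: "('a, 'p) rform \<Rightarrow> bool" where
  "self_imp F \<longleftrightarrow> (\<exists>G. F = Imp G (Prime G))"

fun star_pform :: "'p \<Rightarrow> ('a, 'p) pform \<Rightarrow> ('a, 'p) pform" where
  "star_pform q (Eq l m) = Pred q [l, m]"
| "star_pform q (Pred p ls) = Pred p ls"

fun star :: "'p \<Rightarrow> ('a, 'p) rform \<Rightarrow> ('a, 'p) rform" where
  "star q (Prime F) = Prime (star_pform q F)"
| "star q (Imp F G) = Imp (star_pform q F) (star q G)"

definition occurs_in_basis :: "('a, 'p) rsystem \<Rightarrow> 'p \<Rightarrow> nat \<Rightarrow> bool" where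
  "occurs_in_basis S p n \<longleftrightarrow>
     (\<exists>F\<in>set (basis S). \<exists>ls. length ls = n \<and> Prime (Pred p ls) \<in> subforms F)"

text \<open>The members of $B_S^*$, where \<open>q\<close> is the new predicate symbol $\sim^*$, the variables
  $x_i$ and $y_i$ are \<open>u i\<close> and \<open>v i\<close>, and juxtaposition $xs$ of variables is \<open>[Var x, Var s]\<close>.\<close>

inductive_set star_basis :: "('a, 'p) rsystem \<Rightarrow> 'p \<Rightarrow> var \<Rightarrow> var \<Rightarrow> var \<Rightarrow> var
    \<Rightarrow> (nat \<Rightarrow> var) \<Rightarrow> (nat \<Rightarrow> var) \<Rightarrow> ('a, 'p) rform set"
  for S q x y s t u v where
  basis: "F \<in> set (basis S) \<Longrightarrow> star q F \<in> star_basis S q x y s t u v"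
| refl: "Prime (Pred q [[Var x], [Var x]]) \<in> star_basis S q x y s t u v"
| sym: "Imp (Pred q [[Var x], [Var x]]) (Imp (Pred q [[Var x], [Var y]])
    (Prime (Pred q [[Var y], [Var x]]))) \<in> star_basis S q x y s t u v"
| trans: "Imp (Pred q [[Var x], [Var y]]) (Imp (Pred q [[Var y], [Var s]])
    (Prime (Pred q [[Var x], [Var s]]))) \<in> star_basis S q x y s t u v"
| app: "f \<in> csyms S \<Longrightarrow>
    Imp (Pred q [[App f [Var x]], [App f [Var x]]]) (Imp (Pred q [[Var x], [Var y]])
      (Prime (Pred q [[App f [Var x]], [App f [Var y]]]))) \<in> star_basis S q x y s t u v"
| append_right: "Imp (Pred q [[Var x, Var s], [Var x, Var s]]) (Imp (Pred q [[Var s], [Var t]])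
    (Prime (Pred q [[Var x, Var s], [Var x, Var t]]))) \<in> star_basis S q x y s t u v"
| append_left: "Imp (Pred q [[Var x, Var s], [Var x, Var t]]) (Imp (Pred q [[Var x], [Var y]])
    (Prime (Pred q [[Var x, Var s], [Var y, Var t]]))) \<in> star_basis S q x y s t u v"
| pred: "p \<in> psyms S \<Longrightarrow> n \<ge> 1 \<Longrightarrow> occurs_in_basis S p n \<Longrightarrow>
    pred_cong (\<lambda>l m. Pred q [l, m]) p (map u [1..<Suc n]) (map v [1..<Suc n])
      \<in> star_basis S q x y s t u v"

text \<open>$B_S^*$ is a list enumerating this set in some order; such a list exists because the set is
  finite.\<close>

definition star_system :: "('a, 'p) rsystem \<Rightarrow> 'p \<Rightarrow> ('a, 'p) rform list \<Rightarrow> ('a, 'p) rsystem" where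
  "star_system S q B = \<lparr>csyms = csyms S, psyms = insert q (psyms S), basis = B\<rparr>"

lemma finite_subforms: "finite (subforms F)"
  by (induction F) auto

lemma finite_star_basis:
  assumes "recursive_system S"
  shows "finite (star_basis S q x y s t u v)"
proof -
  define args :: "('a, 'b) rform \<Rightarrow> 'b \<times> nat" where
    "args = (\<lambda>G. case G of Prime (Pred p ls) \<Rightarrow> (p, length ls) | _ \<Rightarrow> undefined)"
  define N where "N = {(p, n). occurs_in_basis S p n}"
  have "N \<subseteq> args ` (\<Union>F\<in>set (basis S). subforms F)"
    by (force simp: N_def args_def occurs_in_basis_def image_iff)
  then have N: "finite N"
    by (rule finite_subset) (simp add: finite_subforms)
  let ?R = "star q ` set (basis S) \<union>
    {Prime (Pred q [[Var x], [Var x]]),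
     Imp (Pred q [[Var x], [Var x]]) (Imp (Pred q [[Var x], [Var y]])
       (Prime (Pred q [[Var y], [Var x]]))),
     Imp (Pred q [[Var x], [Var y]]) (Imp (Pred q [[Var y], [Var s]])
       (Prime (Pred q [[Var x], [Var s]]))),
     Imp (Pred q [[Var x, Var s], [Var x, Var s]]) (Imp (Pred q [[Var s], [Var t]])
       (Prime (Pred q [[Var x, Var s], [Var x, Var t]]))),
     Imp (Pred q [[Var x, Var s], [Var x, Var t]]) (Imp (Pred q [[Var x], [Var y]])
       (Prime (Pred q [[Var x, Var s], [Var y, Var t]])))} \<union>
    (\<lambda>f. Imp (Pred q [[App f [Var x]], [App f [Var x]]]) (Imp (Pred q [[Var x], [Var y]])
       (Prime (Pred q [[App f [Var x]], [App f [Var y]]])))) ` csyms S \<union>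
    (\<lambda>(p, n). pred_cong (\<lambda>l m. Pred q [l, m]) p (map u [1..<Suc n]) (map v [1..<Suc n])) ` N"
  have "star_basis S q x y s t u v \<subseteq> ?R"
  proof
    fix F assume "F \<in> star_basis S q x y s t u v"
    then show "F \<in> ?R"
    proof cases
      case (pred p n)
      then have "F \<in> (\<lambda>(p, n). pred_cong (\<lambda>l m. Pred q [l, m]) p
          (map u [1..<Suc n]) (map v [1..<Suc n])) ` N"
        unfolding N_def by (intro image_eqI[of _ _ "(p, n)"]) auto
      then show ?thesis by blast
    qed auto
  qed
  moreover have "finite ?R"
    using assms N by (simp add: recursive_system_def)
  ultimately show ?thesis
    by (rule finite_subset)
qed

lemma recursive_system_star:
  assumes "recursive_system S" "set B = star_basis S q x y s t u v"
  shows "recursive_system (star_system S q B)"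
proof -
  have pf: "is_pform A P F \<Longrightarrow> is_pform A (insert q P) (star_pform q F)"
    for A P and F :: "('a, 'b) pform"
    by (cases F) auto
  have rf: "is_rform A P F \<Longrightarrow> is_rform A (insert q P) (star q F)"
    for A P and F :: "('a, 'b) rform"
    by (induction F) (auto simp: pf)
  have imps: "is_rform A P (imps Fs G) \<longleftrightarrow> (\<forall>F\<in>set Fs. is_pform A P F) \<and> is_rform A P G"
    for A P Fs and G :: "('a, 'b) rform"
    by (induction Fs) auto
  have two: "is_list A [Var i, Var j]" for A :: "'a set" and i j
    using is_list.append[OF is_list.Var is_list.Var, of A i j] by simp
  have "is_rform (csyms S) (insert q (psyms S)) F" if "F \<in> star_basis S q x y s t u v" for F
    using that
  proof cases
    case (basis G)
    then show ?thesis using assms(1) rf by (auto simp: recursive_system_def)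
  next
    case (pred p n)
    then show ?thesis
      by (auto simp: pred_cong_def imps intro: is_list.Var dest!: set_zip_leftD)
  qed (auto intro: is_list.Var is_list.App two)
  then show ?thesis
    using assms by (simp add: recursive_system_def star_system_def)
qed

end

theory Submission
  imports Defs
begin

text \<open>For (a): if the basis is free of equations, then every derived equation is a literal identity,
  and discharging such identities from a formula that contains equations can only yield an identity
  or a formula $\to F\,F$. Hence no remaining step needs a removed one.

  For (b), from $S^*$ to \<open>S\<close>: by (a) a derivation in $S^*$ may be taken free of $\sim$, and
  replacing $\sim^*$ by $\sim$ turns each member of $B_S^*$ into an R-axiom of \<open>S\<close>. From \<open>S\<close> to
  $S^*$: interpret a prime formula \<open>F\<close> as derivability of $F^*$ in $S^*$; then $\sim$ is a congruence,
  and every R-formula derivable in \<open>S\<close> is a Horn clause that is valid under all substitutions. The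
  axiom for \<open>n\<close>-ary \<open>p\<close> not occurring in $B_S$ is vacuously valid, because by (a) no such atom is
  derivable in $S^*$.\<close>

section \<open>Simultaneous substitution\<close>

text \<open>Replacements of a single variable are not closed under composition, simultaneous
  substitutions are. Invariants quantified over all \<open>\<sigma>\<close> therefore pass through
  rule (c).\<close>

fun sub_item :: "(var \<Rightarrow> 'a item list) \<Rightarrow> 'a item \<Rightarrow> 'a item list" where
  "sub_item \<sigma> (Const a) = [Const a]"
| "sub_item \<sigma> (Var y) = \<sigma> y"
| "sub_item \<sigma> (App f m) = [App f (concat (map (sub_item \<sigma>) m))]"

definition sub_list :: "(var \<Rightarrow> 'a item list) \<Rightarrow> 'a item list \<Rightarrow> 'a item list" where
  "sub_list \<sigma> m = concat (map (sub_item \<sigma>) m)"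

lemma sub_list_simps [simp]:
  "sub_list \<sigma> [] = []"
  "sub_list \<sigma> (i # m) = sub_item \<sigma> i @ sub_list \<sigma> m"
  "sub_list \<sigma> (l @ m) = sub_list \<sigma> l @ sub_list \<sigma> m"
  by (simp_all add: sub_list_def)

lemma sub_item_App [simp]: "sub_item \<sigma> (App f m) = [App f (sub_list \<sigma> m)]"
  by (simp add: sub_list_def)

declare sub_item.simps(3) [simp del]

fun sub_pform :: "(var \<Rightarrow> 'a item list) \<Rightarrow> ('a, 'p) pform \<Rightarrow> ('a, 'p) pform" where
  "sub_pform \<sigma> (Eq l m) = Eq (sub_list \<sigma> l) (sub_list \<sigma> m)"
| "sub_pform \<sigma> (Pred p ls) = Pred p (map (sub_list \<sigma>) ls)"

fun sub_form :: "(var \<Rightarrow> 'a item list) \<Rightarrow> ('a, 'p) rform \<Rightarrow> ('a, 'p) rform" where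
  "sub_form \<sigma> (Prime F) = Prime (sub_pform \<sigma> F)"
| "sub_form \<sigma> (Imp F G) = Imp (sub_pform \<sigma> F) (sub_form \<sigma> G)"

lemma sb_item_eq_sub_item: "sb_item l x i = sub_item (var_list(x := l)) i"
proof (induction i)
  case (App f m)
  then have "map (sb_item l x) m = map (sub_item (var_list(x := l))) m" by (rule map_cong[OF HOL.refl])
  then show ?case by (simp only: sb_item.simps sub_item.simps)
qed auto

lemma sb_list_eq_sub_list: "sb_list m l x = sub_list (var_list(x := l)) m"
  by (simp add: sb_list_def sub_list_def sb_item_eq_sub_item[abs_def])

lemma sb_pform_eq_sub_pform: "sb_pform F l x = sub_pform (var_list(x := l)) F"
  by (cases F) (simp_all add: sb_list_eq_sub_list)

lemma SbF_eq_sub_form: "SbF F l x = sub_form (var_list(x := l)) F"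
  by (induction F) (simp_all only: SbF.simps sub_form.simps sb_pform_eq_sub_pform)

lemma sub_item_sub_list: "sub_list \<tau> (sub_item \<sigma> i) = sub_item (\<lambda>z. sub_list \<tau> (\<sigma> z)) i"
proof (induction i)
  case (App f m)
  then have "sub_list \<tau> (sub_list \<sigma> m) = sub_list (\<lambda>z. sub_list \<tau> (\<sigma> z)) m"
    by (induction m) auto
  then show ?case by simp
qed auto

lemma sub_list_sub_list: "sub_list \<tau> (sub_list \<sigma> m) = sub_list (\<lambda>z. sub_list \<tau> (\<sigma> z)) m"
  by (induction m) (simp_all add: sub_item_sub_list)

lemma sub_pform_sub_pform: "sub_pform \<tau> (sub_pform \<sigma> F) = sub_pform (\<lambda>z. sub_list \<tau> (\<sigma> z)) F"
  by (cases F) (simp_all add: sub_list_sub_list)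

lemma sub_form_sub_form: "sub_form \<tau> (sub_form \<sigma> F) = sub_form (\<lambda>z. sub_list \<tau> (\<sigma> z)) F"
  by (induction F) (simp_all add: sub_pform_sub_pform)

section \<open>Variables of a formula and agreement of substitutions\<close>

fun vars_item :: "'a item \<Rightarrow> var set" where
  "vars_item (Const a) = {}"
| "vars_item (Var y) = {y}"
| "vars_item (App f m) = (\<Union>i\<in>set m. vars_item i)"

definition vars_list :: "'a item list \<Rightarrow> var set" where
  "vars_list m = (\<Union>i\<in>set m. vars_item i)"

fun vars_pform :: "('a, 'p) pform \<Rightarrow> var set" where
  "vars_pform (Eq l m) = vars_list l \<union> vars_list m"
| "vars_pform (Pred p ls) = (\<Union>l\<in>set ls. vars_list l)"

fun vars_form :: "('a, 'p) rform \<Rightarrow> var set" where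
  "vars_form (Prime F) = vars_pform F"
| "vars_form (Imp F G) = vars_pform F \<union> vars_form G"

lemma finite_vars_item: "finite (vars_item i)"
  by (induction i) auto

lemma finite_vars_list: "finite (vars_list m)"
  by (simp add: vars_list_def finite_vars_item)

lemma finite_vars_form: "finite (vars_form F)"
proof -
  have "finite (vars_pform G)" for G :: "('a, 'b) pform"
    by (cases G) (simp_all add: finite_vars_list)
  then show ?thesis by (induction F) auto
qed

lemma sub_item_cong:
  assumes "\<And>z. z \<in> vars_item i \<Longrightarrow> \<sigma> z = \<tau> z"
  shows "sub_item \<sigma> i = sub_item \<tau> i"
  using assms
proof (induction i)
  case (App f m)
  then have "map (sub_item \<sigma>) m = map (sub_item \<tau>) m" by fastforce
  then show ?case by (simp only: sub_item.simps)
qed auto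

lemma sub_list_cong:
  assumes "\<And>z. z \<in> vars_list m \<Longrightarrow> \<sigma> z = \<tau> z"
  shows "sub_list \<sigma> m = sub_list \<tau> m"
proof -
  have "map (sub_item \<sigma>) m = map (sub_item \<tau>) m"
    using assms by (auto simp: vars_list_def intro: sub_item_cong)
  then show ?thesis by (simp only: sub_list_def)
qed

lemma sub_pform_cong:
  assumes "\<And>z. z \<in> vars_pform F \<Longrightarrow> \<sigma> z = \<tau> z"
  shows "sub_pform \<sigma> F = sub_pform \<tau> F"
  using assms by (cases F) (auto intro!: sub_list_cong)

lemma sub_form_cong:
  assumes "\<And>z. z \<in> vars_form F \<Longrightarrow> \<sigma> z = \<tau> z"
  shows "sub_form \<sigma> F = sub_form \<tau> F"
  using assms by (induction F) (auto intro!: sub_pform_cong)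

lemma sub_item_var_list [simp]: "sub_item var_list i = [i]"
proof (induction i)
  case (App f m)
  then have "sub_list var_list m = m" by (induction m) auto
  then show ?case by simp
qed auto

lemma sub_list_var_list [simp]: "sub_list var_list m = m"
  by (induction m) auto

lemma sub_pform_var_list [simp]: "sub_pform var_list F = F"
  by (cases F) (simp_all add: map_idI)

lemma sub_form_var_list [simp]: "sub_form var_list F = F"
  by (induction F) auto

lemma is_list_sub_list:
  assumes "is_list A m" "\<And>z. is_list A (\<sigma> z)"
  shows "is_list A (sub_list \<sigma> m)"
  using assms by (induction) (auto intro: is_list.intros)

lemma sub_form_imps [simp]:
  "sub_form \<sigma> (imps Fs G) = imps (map (sub_pform \<sigma>) Fs) (sub_form \<sigma> G)"
  by (induction Fs) auto

section \<open>Derivability\<close>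

text \<open>Brings the two premises of rule (b), derived separately, into one derivation.\<close>

lemma R_derivation_append:
  assumes "R_derivation S L" "R_derivation S M"
  shows "R_derivation S (L @ M)"
  using assms(2)
proof (induction)
  case Nil
  then show ?case using assms(1) by simp
next
  case (axiom M F)
  then show ?case using R_derivation.axiom[of S "L @ M" F] by simp
next
  case (mp M F G)
  then show ?case using R_derivation.mp[of S "L @ M" F G] by simp
next
  case (subst M F l x)
  then show ?case using R_derivation.subst[of S "L @ M" F l x] by simp
qed

lemma R_derivable_axiom: "R_axiom S F \<Longrightarrow> R_derivable S F"
  unfolding R_derivable_def
  by (intro exI[of _ "[] @ [F]"] conjI R_derivation.axiom R_derivation.Nil) auto

lemma R_derivable_basis: "F \<in> set (basis S) \<Longrightarrow> R_derivable S F"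
  by (simp add: R_derivable_axiom R_axiom_def)

lemma R_derivable_mp:
  assumes "R_derivable S (Prime F)" "R_derivable S (Imp F G)"
  shows "R_derivable S G"
proof -
  obtain L M where "R_derivation S L" "Prime F \<in> set L" "R_derivation S M" "Imp F G \<in> set M"
    using assms by (auto simp: R_derivable_def)
  then have "R_derivation S ((L @ M) @ [G])"
    by (intro R_derivation.mp[of S "L @ M" F G] R_derivation_append) auto
  then show ?thesis by (auto simp: R_derivable_def)
qed

lemma R_derivable_subst:
  assumes "R_derivable S F" "is_list (csyms S) l"
  shows "R_derivable S (sub_form (var_list(x := l)) F)"
proof -
  obtain L where "R_derivation S L" "F \<in> set L"
    using assms by (auto simp: R_derivable_def)
  then have "R_derivation S (L @ [SbF F l x])"
    using assms(2) by (rule R_derivation.subst)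
  then show ?thesis by (auto simp: R_derivable_def SbF_eq_sub_form)
qed

lemma R_derivable_induct [consumes 1, case_names axiom mp subst]:
  assumes "R_derivable S F"
    and "\<And>F. R_axiom S F \<Longrightarrow> Q F"
    and "\<And>F G. Q (Prime F) \<Longrightarrow> Q (Imp F G) \<Longrightarrow> Q G"
    and "\<And>F l x. Q F \<Longrightarrow> is_list (csyms S) l \<Longrightarrow> Q (sub_form (var_list(x := l)) F)"
  shows "Q F"
proof -
  have "R_derivation S L \<Longrightarrow> \<forall>F\<in>set L. Q F" for L
    by (induction rule: R_derivation.induct) (auto intro: assms(2-4) simp: SbF_eq_sub_form)
  then show ?thesis using assms(1) by (auto simp: R_derivable_def)
qed

text \<open>A rule (c) step replaces one variable only, so the variables \<open>< N\<close> of \<open>F\<close> are first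
  moved to the fresh block \<open>N..<2N\<close> and only then replaced by their images.\<close>

lemma R_derivable_sub_form:
  assumes F: "R_derivable S F" and \<sigma>: "\<And>z. is_list (csyms S) (\<sigma> z)"
  shows "R_derivable S (sub_form \<sigma> F)"
proof -
  have "finite (vars_form F \<union> (\<Union>z\<in>vars_form F. vars_list (\<sigma> z)))"
    by (simp add: finite_vars_form finite_vars_list)
  then obtain N where N: "\<And>z. z \<in> vars_form F \<union> (\<Union>z\<in>vars_form F. vars_list (\<sigma> z)) \<Longrightarrow> z < N"
    unfolding finite_nat_set_iff_bounded by blast
  define \<tau> :: "var \<Rightarrow> var \<Rightarrow> 'a item list"
    where "\<tau> n z = (if z < n then [Var (z + N)] else [Var z])" for n z
  \<comment> \<open>The second phase after \<open>n\<close> replacements: variables of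
    \<open>F\<close> from \<open>n\<close> on still sit in the fresh block, so
    \<open>\<rho> 0\<close> agrees with \<open>\<tau> N\<close> on \<open>F\<close>.\<close>
  define \<rho> :: "var \<Rightarrow> var \<Rightarrow> 'a item list"
    where "\<rho> n z = (if z < n then \<sigma> z else [Var (z + N)])" for n z
  have 1: "R_derivable S (sub_form (\<tau> n) F)" if "n \<le> N" for n
    using that
  proof (induction n)
    case 0
    have "\<tau> 0 = var_list" by (auto simp: \<tau>_def)
    then show ?case using F by simp
  next
    case (Suc n)
    \<comment> \<open>Variables already moved are at least \<open>N > n\<close>, so replacing
      \<open>n\<close> does not touch them.\<close>
    have "(\<lambda>z. sub_list (var_list(n := [Var (n + N)])) (\<tau> n z)) = \<tau> (Suc n)"
      using Suc.prems by (auto simp: \<tau>_def)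
    moreover have "R_derivable S (sub_form (var_list(n := [Var (n + N)])) (sub_form (\<tau> n) F))"
      using Suc by (intro R_derivable_subst is_list.Var) auto
    ultimately show ?case by (simp add: sub_form_sub_form)
  qed
  have 2: "R_derivable S (sub_form (\<rho> n) F)" if "n \<le> N" for n
    using that
  proof (induction n)
    case 0
    have "sub_form (\<rho> 0) F = sub_form (\<tau> N) F"
      using N by (intro sub_form_cong) (auto simp: \<tau>_def \<rho>_def)
    then show ?case using 1 by simp
  next
    case (Suc n)
    have "sub_form (\<lambda>z. sub_list (var_list(n + N := \<sigma> n)) (\<rho> n z)) F = sub_form (\<rho> (Suc n)) F"
    proof (rule sub_form_cong)
      fix z assume z: "z \<in> vars_form F"
      \<comment> \<open>The variables of \<open>\<sigma> z\<close> lie below \<open>N\<close>, so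
        replacing \<open>n + N\<close> leaves the images inserted earlier unchanged.\<close>
      have "sub_list (var_list(n + N := \<sigma> n)) (\<sigma> z) = sub_list var_list (\<sigma> z)"
        using N z by (intro sub_list_cong) fastforce
      then show "sub_list (var_list(n + N := \<sigma> n)) (\<rho> n z) = \<rho> (Suc n) z"
        using N z by (auto simp: \<rho>_def less_Suc_eq)
    qed
    moreover have "R_derivable S (sub_form (var_list(n + N := \<sigma> n)) (sub_form (\<rho> n) F))"
      using Suc by (intro R_derivable_subst \<sigma>) auto
    ultimately show ?case by (simp add: sub_form_sub_form)
  qed
  have "sub_form (\<rho> N) F = sub_form \<sigma> F"
    using N by (intro sub_form_cong) (auto simp: \<rho>_def)
  then show ?thesis using 2[of N] by simp
qed

section \<open>Removal of equations\<close>

lemma contains_eq_simps [simp]: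
  "contains_eq (Prime (Eq l m))"
  "\<not> contains_eq (Prime (Pred p ls))"
  "contains_eq (Imp (Eq l m) G)"
  "contains_eq (Imp (Pred p ls) G) \<longleftrightarrow> contains_eq G"
  by (auto simp: contains_eq_def)

lemma contains_eq_Imp: "contains_eq (Imp F G) \<longleftrightarrow> contains_eq (Prime F) \<or> contains_eq G"
  by (cases F) auto

lemma contains_eq_sub_form [simp]: "contains_eq (sub_form \<sigma> F) \<longleftrightarrow> contains_eq F"
proof -
  have "contains_eq (Prime (sub_pform \<sigma> G)) \<longleftrightarrow> contains_eq (Prime G)" for G :: "('a, 'b) pform"
    by (cases G) auto
  then show ?thesis by (induction F) (auto simp: contains_eq_Imp)
qed

text \<open>Used contrapositively: a result of rule (c) that is kept in the filtered list comes from
  a step that is kept.\<close>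

lemma self_imp_sub_form: "self_imp F \<Longrightarrow> self_imp (sub_form \<sigma> F)"
  by (auto simp: self_imp_def)

text \<open>Once all leading equations that hold literally are stripped, a formula satisfying
  \<open>eq_trivial\<close> is a literal identity or of the form $\to F\,F$, or it is guarded by an equation
  between different lists, which rule (b) can never discharge.\<close>

fun eq_trivial :: "('a, 'p) rform \<Rightarrow> bool" where
  "eq_trivial (Prime (Eq l m)) \<longleftrightarrow> l = m"
| "eq_trivial (Prime (Pred p ls)) \<longleftrightarrow> False"
| "eq_trivial (Imp (Eq l m) G) \<longleftrightarrow> (l = m \<longrightarrow> eq_trivial G)"
| "eq_trivial (Imp (Pred p ls) G) \<longleftrightarrow> G = Prime (Pred p ls)"

lemma eq_trivial_pred_cong:
  assumes "length xs = length ys"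
  shows "eq_trivial (sub_form \<sigma> (pred_cong Eq p xs ys))"
proof -
  \<comment> \<open>\<open>ls\<close> collects the arguments whose equations hold literally. If all
    of them do, both argument lists coincide and the core is of the form
    \<open>Imp F (Prime F)\<close>.\<close>
  have "eq_trivial (imps (map2 (\<lambda>x y. Eq (\<sigma> x) (\<sigma> y)) xs ys)
      (Imp (Pred p (ls @ map \<sigma> xs)) (Prime (Pred p (ls @ map \<sigma> ys)))))" for ls
    using assms
  proof (induction xs ys arbitrary: ls rule: list_induct2)
    case (Cons x xs y ys)
    then show ?case using Cons.IH[of "ls @ [\<sigma> x]"] by auto
  qed simp
  from this[of "[]"] show ?thesis
    by (simp add: pred_cong_def case_prod_beta' comp_def)
qed

text \<open>Handles the replacement axiom: once \<open>\<sigma>\<close> identifies the two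
  variables, its first premise and its conclusion have the same instance.\<close>

lemma sub_list_sb_list_var:
  assumes "\<sigma> x = \<sigma> y"
  shows "sub_list \<sigma> (sb_list m (var_list x) y) = sub_list \<sigma> m"
proof -
  have "(\<lambda>z. sub_list \<sigma> ((var_list(y := var_list x)) z)) = \<sigma>"
    using assms by auto
  then show ?thesis by (simp add: sb_list_eq_sub_list sub_list_sub_list)
qed

lemma eq_trivial_eq_axiom:
  assumes "eq_axiom S F"
  shows "eq_trivial (sub_form \<sigma> F)"
  using assms by cases (auto simp: sub_list_sb_list_var eq_trivial_pred_cong)

lemma contains_eq_eq_axiom:
  assumes "eq_axiom S F"
  shows "contains_eq F"
  using assms
proof cases
  case (pred p xs ys)
  then show ?thesis by (cases xs; cases ys) (auto simp: pred_cong_def)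
qed auto

text \<open>All instances are treated at once, so rule (c) only composes substitutions. In rule (b),
  a derived equation is a literal identity and can be stripped from the implication.\<close>

lemma eq_trivial_derivation:
  assumes "R_derivation S L" "\<forall>F\<in>set (basis S). \<not> contains_eq F" "F \<in> set L" "contains_eq F"
  shows "eq_trivial (sub_form \<sigma> F)"
proof -
  have "\<forall>F\<in>set L. contains_eq F \<longrightarrow> (\<forall>\<sigma>. eq_trivial (sub_form \<sigma> F))"
    using assms(1)
  proof (induction)
    case (axiom L F)
    then show ?case using assms(2) by (auto simp: R_axiom_def eq_trivial_eq_axiom)
  next
    case (mp L F G)
    have "eq_trivial (sub_form \<sigma> G)" if G: "contains_eq G" for \<sigma>
    proof (cases F)
      case (Eq l m)
      have "eq_trivial (sub_form \<sigma> (Prime F))" "eq_trivial (sub_form \<sigma> (Imp F G))"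
        using mp Eq by force+
      then show ?thesis using Eq by simp
    next
      case (Pred p ls)
      then have "contains_eq (Imp F G)"
        using G by simp
      \<comment> \<open>This forces \<open>G\<close> to be the prime formula \<open>F\<close>, which
        contains no equation.\<close>
      then have "eq_trivial (sub_form var_list (Imp F G))"
        using mp by blast
      then show ?thesis using Pred G by simp
    qed
    then show ?case using mp by auto
  next
    case (subst L F l x)
    then show ?case by (auto simp: SbF_eq_sub_form sub_form_sub_form)
  qed simp
  then show ?thesis using assms by blast
qed

text \<open>Rule (c) with variable 0 replaced by itself repeats a step. This stands in for rule (b)
  applied to a removed implication \<open>Imp F (Prime F)\<close>.\<close>

lemma R_derivation_repeat:
  assumes "R_derivation S L" "F \<in> set L"
  shows "R_derivation S (L @ [F])"
  using R_derivation.subst[OF assms is_list.Var, of 0 0]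
  by (simp add: SbF_eq_sub_form fun_upd_idem)

lemma R_derivation_remove_eq:
  assumes "R_derivation S L" "\<forall>F\<in>set (basis S). \<not> contains_eq F"
  shows "R_derivation S (filter (\<lambda>F. \<not> contains_eq F \<and> \<not> self_imp F) L)"
  using assms(1)
proof (induction)
  case Nil
  then show ?case by (simp add: R_derivation.Nil)
next
  case (axiom L F)
  then show ?case by (auto intro: R_derivation.axiom)
next
  case (mp L F G)
  let ?L = "filter (\<lambda>F. \<not> contains_eq F \<and> \<not> self_imp F) L"
  have "R_derivation S (?L @ [G])" if G: "\<not> contains_eq G" "\<not> self_imp G"
  proof (cases F)
    case (Eq l m)
    have "eq_trivial (sub_form var_list (Prime F))" "eq_trivial (sub_form var_list (Imp F G))"
      using eq_trivial_derivation[OF mp.hyps(1) assms(2) mp.hyps(2), of var_list]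
        eq_trivial_derivation[OF mp.hyps(1) assms(2) mp.hyps(3), of var_list] Eq
      by simp_all
    \<comment> \<open>Such a \<open>G\<close> contains an equation or satisfies
      \<open>self_imp\<close>, so it would have been removed itself.\<close>
    then have "eq_trivial G"
      using Eq by simp
    then show ?thesis
      using G by (cases G rule: eq_trivial.cases) (auto simp: self_imp_def)
  next
    case (Pred p ls)
    then have F: "Prime F \<in> set ?L"
      using mp.hyps by (auto simp: self_imp_def)
    show ?thesis
    proof (cases "self_imp (Imp F G)")
      case True
      then show ?thesis
        using F mp.IH by (auto simp: self_imp_def intro: R_derivation_repeat)
    next
      case False
      then show ?thesis
        using F mp G Pred by (intro R_derivation.mp[of S ?L F G]) auto
    qed
  qed
  then show ?case using mp.IH by simp
next
  case (subst L F l x)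
  then show ?case
    using self_imp_sub_form[of F] R_derivation.subst[of S "filter _ L" F l x]
    by (auto simp: SbF_eq_sub_form)
qed

text \<open>Part (a) as an induction principle: every equality axiom contains an equation, so a
  filtered derivation uses basis axioms only.\<close>

lemma eq_free_derivable_induct [consumes 2, case_names basis mp subst]:
  assumes "R_derivable S (Prime (Pred p ls))" "\<forall>F\<in>set (basis S). \<not> contains_eq F"
    and "\<And>F. F \<in> set (basis S) \<Longrightarrow> Q F"
    and "\<And>F G. Q (Prime F) \<Longrightarrow> Q (Imp F G) \<Longrightarrow> Q G"
    and "\<And>F l x. Q F \<Longrightarrow> is_list (csyms S) l \<Longrightarrow> Q (sub_form (var_list(x := l)) F)"
  shows "Q (Prime (Pred p ls))"
proof -
  have *: "R_derivation S L \<Longrightarrow> \<forall>F\<in>set L. \<not> contains_eq F \<Longrightarrow> \<forall>F\<in>set L. Q F" for L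
  proof (induction rule: R_derivation.induct)
    case (axiom L F)
    then show ?case using assms(3) contains_eq_eq_axiom by (auto simp: R_axiom_def)
  qed (auto intro: assms(4,5) simp: SbF_eq_sub_form)
  obtain L where L: "R_derivation S L" "Prime (Pred p ls) \<in> set L"
    using assms(1) by (auto simp: R_derivable_def)
  show ?thesis
    using *[OF R_derivation_remove_eq[OF L(1) assms(2)]] L(2) by (auto simp: self_imp_def)
qed

section \<open>Horn semantics\<close>

text \<open>Truth of a Horn clause when \<open>D\<close> is the set of true prime formulas.
  Variables are not interpreted; they are dealt with by substituting beforehand.\<close>

fun holds :: "(('a, 'p) pform \<Rightarrow> bool) \<Rightarrow> ('a, 'p) rform \<Rightarrow> bool" where
  "holds D (Prime F) \<longleftrightarrow> D F"
| "holds D (Imp F G) \<longleftrightarrow> (D F \<longrightarrow> holds D G)"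

lemma holds_imps [simp]: "holds D (imps Fs G) \<longleftrightarrow> ((\<forall>F\<in>set Fs. D F) \<longrightarrow> holds D G)"
  by (induction Fs) auto

lemma holds_star [simp]: "holds D (star q G) \<longleftrightarrow> holds (\<lambda>F. D (star_pform q F)) G"
  by (induction G) auto

lemma R_derivable_holds: "R_derivable S G \<Longrightarrow> holds (\<lambda>F. R_derivable S (Prime F)) G"
  by (induction G) (auto dest: R_derivable_mp)

lemma star_pform_sub_pform: "star_pform q (sub_pform \<sigma> F) = sub_pform \<sigma> (star_pform q F)"
  by (cases F) auto

lemma star_sub_form: "star q (sub_form \<sigma> F) = sub_form \<sigma> (star q F)"
  by (induction F) (auto simp: star_pform_sub_pform)

lemma not_contains_eq_star [simp]: "\<not> contains_eq (star q F)"
proof -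
  have "\<not> contains_eq (Prime (star_pform q G))" for G :: "('a, 'b) pform"
    by (cases G) auto
  then show ?thesis by (induction F) (auto simp: contains_eq_Imp)
qed

section \<open>Equality as a predicate\<close>

locale star_ext =
  fixes S :: "('a, 'p) rsystem" and q :: 'p and B :: "('a, 'p) rform list"
    and x y s t :: var and u v :: "nat \<Rightarrow> var"
  assumes rec_sys: "recursive_system S"
    and q: "q \<notin> psyms S"
    and dist: "distinct [x, y, s, t]"
    and inj_u: "inj u" and inj_v: "inj v" and disj: "range u \<inter> range v = {}"
    and B: "set B = star_basis S q x y s t u v"
begin

abbreviation "T \<equiv> star_system S q B"
abbreviation "D F \<equiv> R_derivable T (Prime F)"
abbreviation "is_l \<equiv> is_list (csyms S)"

lemma csyms_T [simp]: "csyms T = csyms S"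
  by (simp add: star_system_def)

lemma basis_T [simp]: "basis T = B"
  by (simp add: star_system_def)

lemma dist_vars [simp]:
  "x \<noteq> y" "x \<noteq> s" "x \<noteq> t" "y \<noteq> s" "y \<noteq> t" "s \<noteq> t"
  "y \<noteq> x" "s \<noteq> x" "t \<noteq> x" "s \<noteq> y" "t \<noteq> y" "t \<noteq> s"
  using dist by auto

text \<open>Makes part (a) applicable to \<open>T\<close>.\<close>

lemma eq_free_basis: "\<forall>F\<in>set (basis T). \<not> contains_eq F"
proof
  fix F assume "F \<in> set (basis T)"
  then have "F \<in> star_basis S q x y s t u v" by (simp add: B)
  then show "\<not> contains_eq F"
  proof cases
    case (pred p n)
    have "\<not> contains_eq (imps (map (\<lambda>(x, y). Pred q [[Var x], [Var y]]) zs)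
        (Imp (Pred p ls) (Prime (Pred p ms))))"
      for zs :: "(var \<times> var) list" and ls ms :: "'a item list list"
      by (induction zs) auto
    then show ?thesis using pred by (simp add: pred_cong_def del: upt_Suc)
  qed auto
qed

subsection \<open>From the extended system to the original one\<close>

text \<open>Inverts \<open>star_pform q\<close> on formulas over \<open>psyms S\<close>, where
  \<open>q\<close> does not occur. Atoms of \<open>q\<close> with another arity than 2 come from no
  equation and are left alone.\<close>

fun unstar_pform :: "('a, 'p) pform \<Rightarrow> ('a, 'p) pform" where
  "unstar_pform (Eq l m) = Eq l m"
| "unstar_pform (Pred p ls) = (if p = q \<and> length ls = 2 then Eq (ls ! 0) (ls ! 1) else Pred p ls)"

fun unstar :: "('a, 'p) rform \<Rightarrow> ('a, 'p) rform" where
  "unstar (Prime F) = Prime (unstar_pform F)"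
| "unstar (Imp F G) = Imp (unstar_pform F) (unstar G)"

lemma unstar_sub_form: "unstar (sub_form \<sigma> F) = sub_form \<sigma> (unstar F)"
proof -
  have "unstar_pform (sub_pform \<sigma> F) = sub_pform \<sigma> (unstar_pform F)" for F
    by (cases F) auto
  then show ?thesis by (induction F) auto
qed

lemma unstar_star:
  assumes "is_rform A (psyms S) F"
  shows "unstar (star q F) = F"
proof -
  have "is_pform A (psyms S) F \<Longrightarrow> unstar_pform (star_pform q F) = F" for F
    using q by (cases F) auto
  then show ?thesis using assms by (induction F) auto
qed

lemma unstar_imps: "unstar (imps Fs G) = imps (map unstar_pform Fs) (unstar G)"
  by (induction Fs) auto

lemma is_list_two: "is_l [Var i, Var j]"
  using is_list.append[OF is_list.Var is_list.Var, of _ i j] by simp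

text \<open>Each member of $B_S^*$ becomes an R-axiom of \<open>S\<close>; the redundant-looking premises in (iii)
  and (v)-(vii) make these instances of the replacement axiom.\<close>

lemma R_axiom_unstar:
  assumes "F \<in> set B"
  shows "R_axiom S (unstar F)"
proof -
  have ax: "R_axiom S (Imp (Eq (sb_list l [Var i] j) (sb_list m [Var i] j))
      (Imp (Eq [Var i] [Var j]) (Prime (Eq l m))))" if "is_l l" "is_l m" for l m i j
    using eq_axiom.subst[OF that, of i j] by (simp add: R_axiom_def)
  have "F \<in> star_basis S q x y s t u v"
    using assms B by simp
  then show ?thesis
  proof cases
    case (basis G)
    then show ?thesis
      using rec_sys unstar_star[of "csyms S" G] by (auto simp: recursive_system_def R_axiom_def)
  next
    case refl
    then show ?thesis using eq_axiom.refl[of S x] by (simp add: R_axiom_def)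
  next
    case sym
    then show ?thesis
      using ax[of "[Var y]" "[Var x]" x y] by (simp add: sb_list_def is_list.Var)
  next
    case trans
    then show ?thesis
      using ax[of "[Var x]" "[Var s]" y s] by (simp add: sb_list_def is_list.Var)
  next
    case (app f)
    then show ?thesis
      using ax[of "[App f [Var x]]" "[App f [Var y]]" x y]
      by (simp add: sb_list_def is_list.App is_list.Var)
  next
    case append_right
    then show ?thesis
      using ax[of "[Var x, Var s]" "[Var x, Var t]" s t] by (simp add: sb_list_def is_list_two)
  next
    case append_left
    then show ?thesis
      using ax[of "[Var x, Var s]" "[Var y, Var t]" x y] by (simp add: sb_list_def is_list_two)
  next
    case (pred p n)
    then have "p \<noteq> q" using q by auto
    then have "unstar F = pred_cong Eq p (map u [1..<Suc n]) (map v [1..<Suc n])"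
      using pred(1) by (simp add: pred_cong_def unstar_imps case_prod_beta' comp_def)
    then show ?thesis
      using pred eq_axiom.pred[of p S "map u [1..<Suc n]" "map v [1..<Suc n]"]
      by (simp add: R_axiom_def)
  qed
qed

text \<open>\<open>unstar\<close> commutes with rules (b) and (c), so it carries an equation-free
  derivation in \<open>T\<close> over to \<open>S\<close>.\<close>

lemma R_derivable_unstar:
  assumes "D (Pred p ls)"
  shows "R_derivable S (unstar (Prime (Pred p ls)))"
  using assms eq_free_basis
proof (induction rule: eq_free_derivable_induct)
  case (basis F)
  then show ?case by (simp add: R_axiom_unstar R_derivable_axiom)
next
  case (mp F G)
  then show ?case by (auto intro: R_derivable_mp)
next
  case (subst F l x)
  then show ?case by (simp add: unstar_sub_form R_derivable_subst)
qed

subsection \<open>From the original system to the extended one\<close>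

text \<open>Turns each scheme of the extended basis into a closure property of
  \<open>D\<close>.\<close>

lemma holds_instance:
  assumes "F \<in> star_basis S q x y s t u v" "\<forall>z. is_l (\<sigma> z)"
  shows "holds D (sub_form \<sigma> F)"
  using assms B by (intro R_derivable_holds R_derivable_sub_form R_derivable_basis) auto

section \<open>The new predicate is a congruence on lists\<close>

lemma cong_refl: "is_l l \<Longrightarrow> D (Pred q [l, l])"
  using holds_instance[OF star_basis.refl, of "var_list(x := l)"] by (simp add: is_list.Var)

lemma cong_sym:
  assumes "D (Pred q [l, m])" "is_l l" "is_l m"
  shows "D (Pred q [m, l])"
  using holds_instance[OF star_basis.sym, of "var_list(x := l, y := m)"] cong_refl assms
  by (simp add: is_list.Var)

lemma cong_trans:
  assumes "D (Pred q [l, m])" "D (Pred q [m, k])" "is_l l" "is_l m" "is_l k"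
  shows "D (Pred q [l, k])"
  using holds_instance[OF star_basis.trans, of "var_list(x := l, y := m, s := k)"] assms
  by (simp add: is_list.Var)

lemma cong_App:
  assumes "D (Pred q [l, m])" "is_l l" "is_l m" "f \<in> csyms S"
  shows "D (Pred q [[App f l], [App f m]])"
  using holds_instance[OF star_basis.app, of f "var_list(x := l, y := m)"] assms
    cong_refl[OF is_list.App[of f "csyms S" l]]
  by (simp add: is_list.Var)

lemma cong_append:
  assumes "D (Pred q [l, m])" "D (Pred q [l', m'])" "is_l l" "is_l m" "is_l l'" "is_l m'"
  shows "D (Pred q [l @ l', m @ m'])"
proof -
  let ?\<sigma> = "var_list(x := l, y := m, s := l', t := m')"
  have \<sigma>: "is_l (?\<sigma> z)" for z
    using assms is_list.Var by auto
  \<comment> \<open>The right factor changes first, by (vi) and reflexivity; the result is the first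
    premise of (vii), which then changes the left factor.\<close>
  have "D (Pred q [l @ l', l @ m'])"
    using holds_instance[OF star_basis.append_right, of ?\<sigma>] \<sigma> assms
      cong_refl[OF is_list.append[of "csyms S" l l']]
    by simp
  then show ?thesis
    using holds_instance[OF star_basis.append_left, of ?\<sigma>] \<sigma> assms by simp
qed

lemma cong_sub_list:
  assumes "is_l m" "\<And>z. D (Pred q [\<sigma> z, \<tau> z])" "\<And>z. is_l (\<sigma> z)" "\<And>z. is_l (\<tau> z)"
  shows "D (Pred q [sub_list \<sigma> m, sub_list \<tau> m])"
  using assms(1)
proof (induction)
  case (Const a)
  then show ?case by (simp add: cong_refl is_list.Const)
next
  case (Var z)
  then show ?case by (simp add: assms)
next
  case (App f l)
  then show ?case by (simp add: cong_App is_list_sub_list assms)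
next
  case (append l m)
  then show ?case by (simp add: cong_append is_list_sub_list assms)
qed

text \<open>Rules (b) and (c) create no new arities, so the arity of a derived atom of
  \<open>p\<close> goes back to the basis of \<open>T\<close>. There \<open>p\<close>, being
  different from \<open>q\<close>, occurs only in starred members of \<open>basis S\<close> and in
  (viii), which is restricted to arities occurring in \<open>basis S\<close>.\<close>

lemma occurs_in_basis_derivable:
  assumes "D (Pred p ls)" "p \<in> psyms S"
  shows "occurs_in_basis S p (length ls)"
proof -
  define Q where "Q F \<longleftrightarrow> (\<forall>ls. Prime (Pred p ls) \<in> subforms F \<longrightarrow> occurs_in_basis S p (length ls))"
    for F :: "('a, 'p) rform"
  have Q_Imp: "Q (Imp F G) \<longleftrightarrow> Q (Prime F) \<and> Q G" for F G
    by (auto simp: Q_def)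
  have pne: "p \<noteq> q" using q assms(2) by auto
  have "Q (Prime (Pred p ls))"
    using assms(1) eq_free_basis
  proof (induction rule: eq_free_derivable_induct)
    case (basis F)
    then have "F \<in> star_basis S q x y s t u v" by (simp add: B)
    then show ?case
    proof cases
      case (basis G)
      have "Prime (Pred p ls) \<in> subforms (star q G) \<Longrightarrow> Prime (Pred p ls) \<in> subforms G"
        for ls and G :: "('a, 'p) rform"
      proof -
        have *: "star_pform q H = Pred p ls \<longleftrightarrow> H = Pred p ls" for H :: "('a, 'p) pform"
          using pne by (cases H) auto
        show "Prime (Pred p ls) \<in> subforms (star q G) \<Longrightarrow> Prime (Pred p ls) \<in> subforms G"
          by (induction G) (auto simp: * eq_commute[of "Pred p ls"])
      qed
      then show ?thesis using basis by (auto simp: Q_def occurs_in_basis_def)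
    next
      case (pred p' n)
      have "Q (imps (map (\<lambda>(x, y). Pred q [[Var x], [Var y]]) zs) G) \<longleftrightarrow> Q G"
        for zs :: "(var \<times> var) list" and G
        using pne by (induction zs) (auto simp: Q_def)
      moreover have "Q (Imp (Pred p' (map var_list (map u [1..<Suc n])))
          (Prime (Pred p' (map var_list (map v [1..<Suc n])))))"
        using pred by (auto simp: Q_def)
      ultimately show ?thesis using pred(1) by (simp add: pred_cong_def)
    qed (use pne in \<open>auto simp: Q_def\<close>)
  next
    case (mp F G)
    then show ?case by (simp add: Q_Imp)
  next
    case (subst F l z)
    have "Q (Prime (sub_pform \<sigma> H)) \<longleftrightarrow> Q (Prime H)" for \<sigma> H
      by (cases H) (auto simp: Q_def)
    then have "Q (sub_form \<sigma> F) \<longleftrightarrow> Q F" for \<sigma>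
      by (induction F) (auto simp: Q_Imp)
    then show ?case using subst by simp
  qed
  then show ?thesis by (simp add: Q_def)
qed

lemma cong_Pred:
  assumes "D (Pred p ls)" "p \<in> psyms S" "length ls = length ms" "ls \<noteq> []"
    and is_l: "\<And>l. l \<in> set ls \<Longrightarrow> is_l l" "\<And>m. m \<in> set ms \<Longrightarrow> is_l m"
    and cong: "\<And>i. i < length ls \<Longrightarrow> D (Pred q [ls ! i, ms ! i])"
  shows "D (Pred p ms)"
proof -
  let ?n = "length ls"
  \<comment> \<open>Instantiates (viii). Its variables are numbered from 1 and list positions from
    0, hence the shift; injectivity and disjoint ranges of \<open>u\<close> and \<open>v\<close>
    prevent clashes.\<close>
  define \<sigma> where "\<sigma> z = (if z \<in> u ` {1..?n} then ls ! (inv u z - 1)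
    else if z \<in> v ` {1..?n} then ms ! (inv v z - 1) else [Var z])" for z
  have u: "\<sigma> (u i) = ls ! (i - 1)" if "i \<in> {1..?n}" for i
    using that inj_u by (auto simp: \<sigma>_def)
  have v: "\<sigma> (v i) = ms ! (i - 1)" if "i \<in> {1..?n}" for i
    using that inj_v disj by (auto simp: \<sigma>_def)
  have "is_l (ls ! (i - 1))" "is_l (ms ! (i - 1))" if "i \<in> {1..?n}" for i
    using that assms(3) by (auto intro!: is_l(1)[OF nth_mem] is_l(2)[OF nth_mem])
  then have \<sigma>: "\<forall>z. is_l (\<sigma> z)"
    using inj_u inj_v by (auto simp: \<sigma>_def is_list.Var)
  have us: "map \<sigma> (map u [1..<Suc ?n]) = ls" and vs: "map \<sigma> (map v [1..<Suc ?n]) = ms"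
    using u v assms(3) by (auto intro!: nth_equalityI simp del: upt_Suc)
  \<comment> \<open>The derivable atom itself shows that (viii) is available for this arity.\<close>
  have "occurs_in_basis S p ?n"
    using assms occurs_in_basis_derivable by blast
  then have "holds D (sub_form \<sigma> (pred_cong (\<lambda>l m. Pred q [l, m]) p
      (map u [1..<Suc ?n]) (map v [1..<Suc ?n])))"
    using assms by (intro holds_instance star_basis.pred \<sigma>) (auto simp: Suc_le_eq)
  moreover have "D (Pred q [\<sigma> (u i), \<sigma> (v i)])" if "i \<in> {1..?n}" for i
    using u[OF that] v[OF that] that by (auto intro!: cong)
  ultimately show ?thesis
    using us vs assms(1)
    by (auto simp: pred_cong_def set_zip comp_def simp del: upt_Suc)
qed

text \<open>Soundness of \<open>S\<close> for the interpretation by derivability in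
  \<open>T\<close>. The induction quantifies over all \<open>\<sigma>\<close>, so that rule (c)
  becomes composition and rule (b) becomes modus ponens.\<close>

lemma holds_star_derivable:
  assumes "R_derivable S F" "\<And>z. is_l (\<sigma> z)"
  shows "holds (\<lambda>F. D (star_pform q F)) (sub_form \<sigma> F)"
proof -
  let ?D = "\<lambda>F. D (star_pform q F)"
  have "\<forall>\<sigma>. (\<forall>z. is_l (\<sigma> z)) \<longrightarrow> holds ?D (sub_form \<sigma> F)"
    using assms(1)
  proof (induction rule: R_derivable_induct)
    case (axiom F)
    have "holds ?D (sub_form \<sigma> F)" if \<sigma>: "\<And>z. is_l (\<sigma> z)" for \<sigma>
    proof (cases "F \<in> set (basis S)")
      case True
      then show ?thesis
        using holds_instance[OF star_basis.basis, of F \<sigma>] \<sigma> by (simp flip: star_sub_form)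
    next
      case False
      then have "eq_axiom S F" using axiom by (simp add: R_axiom_def)
      then show ?thesis
      proof cases
        case (refl z)
        then show ?thesis by (simp add: cong_refl \<sigma>)
      next
        case (subst l m a b)
        \<comment> \<open>\<open>\<tau>\<close> gives the instance of the first premise of the
          replacement axiom. The conclusion follows along the chain from
          \<open>sub_list \<sigma> l\<close> via \<open>sub_list \<tau> l\<close> and
          \<open>sub_list \<tau> m\<close> to \<open>sub_list \<sigma> m\<close>.\<close>
        define \<tau> where "\<tau> = (\<lambda>z. sub_list \<sigma> ((var_list(b := var_list a)) z))"
        have \<tau>: "is_l (\<tau> z)" for z
          by (simp add: \<tau>_def \<sigma>)
        have "D (Pred q [sub_list \<sigma> l, sub_list \<sigma> m])"
          if 1: "D (Pred q [sub_list \<tau> l, sub_list \<tau> m])" and 2: "D (Pred q [\<sigma> a, \<sigma> b])"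
        proof -
          \<comment> \<open>The two substitutions differ at most at \<open>b\<close>, where
            \<open>\<tau> b = \<sigma> a\<close>.\<close>
          have *: "D (Pred q [\<tau> z, \<sigma> z])" for z
            using 2 by (simp add: \<tau>_def cong_refl \<sigma>)
          have k: "D (Pred q [sub_list \<tau> k, sub_list \<sigma> k])"
            "is_l (sub_list \<tau> k)" "is_l (sub_list \<sigma> k)" if "is_l k" for k
            by (rule cong_sub_list[OF that * \<tau> \<sigma>] is_list_sub_list[OF that \<tau>]
                is_list_sub_list[OF that \<sigma>])+
          have "D (Pred q [sub_list \<sigma> l, sub_list \<tau> l])"
            using k[OF subst(2)] by (rule cong_sym)
          moreover have "D (Pred q [sub_list \<tau> l, sub_list \<sigma> m])"
            using 1 k(1)[OF subst(3)] k(2)[OF subst(2)] k(2,3)[OF subst(3)] by (rule cong_trans)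
          ultimately show ?thesis
            using k(3)[OF subst(2)] k(2)[OF subst(2)] k(3)[OF subst(3)] by (rule cong_trans)
        qed
        moreover have "sub_list \<sigma> (sb_list k (var_list a) b) = sub_list \<tau> k" for k
          by (simp only: \<tau>_def sb_list_eq_sub_list sub_list_sub_list)
        ultimately show ?thesis
          by (simp add: subst(1))
      next
        case (pred p xs ys)
        \<comment> \<open>The variables in \<open>xs\<close> and \<open>ys\<close> may repeat,
          unlike those of (viii), and the arity need not occur in \<open>basis S\<close>.
          \<open>cong_Pred\<close> covers this because it concerns arbitrary argument lists of a
          derivable atom.\<close>
        have "D (Pred p (map \<sigma> ys))" if "D (Pred p (map \<sigma> xs))"
            and eqs: "\<forall>z\<in>set (zip xs ys). D (Pred q [\<sigma> (fst z), \<sigma> (snd z)])"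
        proof (rule cong_Pred[OF that(1) pred(2)])
          show "map \<sigma> xs \<noteq> []" using pred(4) by auto
          show "D (Pred q [map \<sigma> xs ! i, map \<sigma> ys ! i])" if "i < length (map \<sigma> xs)" for i
            using that pred(3) eqs by (auto simp: set_zip)
        qed (use pred(3) \<sigma> in auto)
        then show ?thesis
          by (simp add: pred(1) pred_cong_def comp_def case_prod_beta')
      qed
    qed
    then show ?case by blast
  next
    case (mp F G)
    then show ?case by simp
  next
    case (subst F l a)
    have "is_l (sub_list \<sigma> ((var_list(a := l)) z))" if "\<forall>z. is_l (\<sigma> z)" for \<sigma> z
      using that subst(2) by (simp add: is_list_sub_list)
    then show ?case using subst(1) by (simp add: sub_form_sub_form)
  qed
  then show ?thesis using assms(2) by blast
qed

lemma R_derivable_star: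
  assumes "R_derivable S (Prime F)"
  shows "D (star_pform q F)"
  using holds_star_derivable[OF assms, of var_list] by (simp add: is_list.Var)

end

theorem mainTheorem2:
  fixes S :: "('a, 'p) rsystem"
    and \<Lambda> Bstar :: "('a, 'p) rform list"
    and q :: 'p
    and x y s t :: var
    and u v :: "nat \<Rightarrow> var"
  assumes "recursive_system S"
    and "R_derivation S \<Lambda>"
  shows "((\<forall>F\<in>set (basis S). \<not> contains_eq F) \<longrightarrow>
            R_derivation S (filter (\<lambda>F. \<not> contains_eq F \<and> \<not> self_imp F) \<Lambda>))
       \<and> (q \<notin> psyms S \<and> distinct [x, y, s, t]
            \<and> inj u \<and> inj v \<and> range u \<inter> range v = {}
            \<and> set Bstar = star_basis S q x y s t u v \<longrightarrow>
            (\<forall>p\<in>psyms S. \<forall>ls. (\<forall>l\<in>set ls. is_list (csyms S) l) \<longrightarrow>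
               (R_derivable S (Prime (Pred p ls)) \<longleftrightarrow>
                R_derivable (star_system S q Bstar) (Prime (Pred p ls))))
          \<and> (\<forall>l m. is_list (csyms S) l \<and> is_list (csyms S) m \<longrightarrow>
               (R_derivable S (Prime (Eq l m)) \<longleftrightarrow>
                R_derivable (star_system S q Bstar) (Prime (Pred q [l, m])))))"
proof (intro conjI impI)
  assume "\<forall>F\<in>set (basis S). \<not> contains_eq F"
  then show "R_derivation S (filter (\<lambda>F. \<not> contains_eq F \<and> \<not> self_imp F) \<Lambda>)"
    using assms(2) R_derivation_remove_eq by blast
next
  assume "q \<notin> psyms S \<and> distinct [x, y, s, t] \<and> inj u \<and> inj v \<and> range u \<inter> range v = {}
    \<and> set Bstar = star_basis S q x y s t u v"
  then interpret star_ext S q Bstar x y s t u v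
    using assms(1) by unfold_locales auto
  show "\<forall>p\<in>psyms S. \<forall>ls. (\<forall>l\<in>set ls. is_list (csyms S) l) \<longrightarrow>
      (R_derivable S (Prime (Pred p ls)) \<longleftrightarrow>
       R_derivable (star_system S q Bstar) (Prime (Pred p ls)))"
    using R_derivable_star[of "Pred _ _"] R_derivable_unstar q
    by (fastforce split: if_splits)
  show "\<forall>l m. is_list (csyms S) l \<and> is_list (csyms S) m \<longrightarrow>
      (R_derivable S (Prime (Eq l m)) \<longleftrightarrow>
       R_derivable (star_system S q Bstar) (Prime (Pred q [l, m])))"
    using R_derivable_star[of "Eq _ _"] R_derivable_unstar[of q "[_, _]"] by auto
qed

end
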